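(* Let $\mathbf{F}_m$ be the free group on $m$ standard generators. There exists an algorithm which, given a word $w\in\mathbf{F}_m$ of standard length $n$, computes the conjugation invariant word norm $\|w\|$. Its complexity is $O(n^3)$ in time and $O(n^2)$ in memory.
   Context: Let $S$ be the set consisting of the standard free generators of $\mathbf{F}_m$ and their inverses, and let $\overline S$ be the set of all conjugates in $\mathbf{F}_m$ of elements of $S$. The standard length of $w$ is its word length with respect to $S$. The conjugation invariant (biinvariant) word norm is $\|w\|=\min\{k\ge 0 : w=s_1\cdots s_k,\ s_i\in\overline S\}$. Time is measured by the number of elementary operations (comparisons and additions of integers of size at most $n$, comparisons of letters) and memory by the number of stored integers. *)

theory Defs
  imports "HOL-Algebra.Group" "HOL-Library.Landau_Symbols"
begin

section \<open>The free group on \<open>m\<close> generators\<close>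

text \<open>The letter \<open>(i, True)\<close> is the generator \<open>a\<^sub>i\<close>, and \<open>(i, False)\<close> is its inverse. The free
  group is realised on reduced words, so an element \<^emph>\<open>is\<close> its reduced word.\<close>

type_synonym letter = "nat \<times> bool"

definition inv_letter :: "letter \<Rightarrow> letter" where
  "inv_letter x = (fst x, \<not> snd x)"

definition reduced :: "letter list \<Rightarrow> bool" where
  "reduced = successively (\<lambda>x y. y \<noteq> inv_letter x)"

fun cons_reduce :: "letter \<Rightarrow> letter list \<Rightarrow> letter list" where
  "cons_reduce x [] = [x]"
| "cons_reduce x (y # w) = (if y = inv_letter x then w else x # y # w)"

definition free_group :: "nat \<Rightarrow> letter list monoid" where
  "free_group m =
     \<lparr> carrier = {w. reduced w \<and> (\<forall>x\<in>set w. fst x < m)},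
       mult = (\<lambda>u v. foldr cons_reduce u v),
       one = [] \<rparr>"

lemma inv_letter_inv_letter [simp]: "inv_letter (inv_letter x) = x"
  by (simp add: inv_letter_def)

lemma fst_inv_letter [simp]: "fst (inv_letter x) = fst x"
  by (simp add: inv_letter_def)

lemma reduced_Nil [simp]: "reduced []"
  by (simp add: reduced_def)

lemma reduced_Cons:
  "reduced (x # w) \<longleftrightarrow> reduced w \<and> (w = [] \<or> hd w \<noteq> inv_letter x)"
  by (cases w) (auto simp: reduced_def)

lemma reduced_cons_reduce: "reduced w \<Longrightarrow> reduced (cons_reduce x w)"
  by (cases w) (auto simp: reduced_Cons)

lemma reduced_foldr: "reduced v \<Longrightarrow> reduced (foldr cons_reduce u v)"
  by (induction u) (auto intro: reduced_cons_reduce)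

lemma set_cons_reduce: "set (cons_reduce x w) \<subseteq> insert x (set w)"
  by (cases w) auto

lemma set_foldr: "set (foldr cons_reduce u v) \<subseteq> set u \<union> set v"
  by (induction u) (use set_cons_reduce in fastforce)+

lemma cons_reduce_inv:
  "reduced w \<Longrightarrow> cons_reduce (inv_letter x) (cons_reduce x w) = w"
  by (cases w rule: list.exhaust; cases "tl w") (auto simp: reduced_Cons)

lemma foldr_cons_reduce:
  assumes "reduced z"
  shows "foldr cons_reduce (cons_reduce x v) z = cons_reduce x (foldr cons_reduce v z)"
proof (cases v)
  case (Cons y v')
  show ?thesis
  proof (cases "y = inv_letter x")
    case True
    have "cons_reduce (inv_letter y) (cons_reduce y (foldr cons_reduce v' z)) = foldr cons_reduce v' z"
      by (intro cons_reduce_inv reduced_foldr assms)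
    with True Cons show ?thesis by simp
  qed (use Cons in simp)
qed simp

lemma foldr_foldr_cons_reduce:
  "reduced z \<Longrightarrow>
     foldr cons_reduce (foldr cons_reduce u v) z = foldr cons_reduce u (foldr cons_reduce v z)"
  by (induction u) (simp_all add: foldr_cons_reduce)

lemma foldr_cons_reduce_Nil: "reduced w \<Longrightarrow> foldr cons_reduce w [] = w"
proof (induction w)
  case (Cons x w)
  then show ?case by (cases w) (auto simp: reduced_Cons)
qed simp

lemma foldr_cons_reduce_inverse:
  "reduced z \<Longrightarrow> foldr cons_reduce (rev (map inv_letter w)) (foldr cons_reduce w z) = z"
  by (induction w) (simp_all add: cons_reduce_inv reduced_foldr)

lemma reduced_inverse: "reduced w \<Longrightarrow> reduced (rev (map inv_letter w))"
proof -
  assume "reduced w"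
  then have "successively (\<lambda>x y. inv_letter x \<noteq> y) w"
    unfolding reduced_def by (rule successively_mono) auto
  then show ?thesis
    unfolding reduced_def
    by (simp add: successively_map)
qed

lemma group_free_group: "group (free_group m)"
proof (rule groupI)
  fix w assume w: "w \<in> carrier (free_group m)"
  show "\<exists>v\<in>carrier (free_group m). v \<otimes>\<^bsub>free_group m\<^esub> w = \<one>\<^bsub>free_group m\<^esub>"
  proof
    show "rev (map inv_letter w) \<in> carrier (free_group m)"
      using w by (auto simp: free_group_def reduced_inverse)
    have "foldr cons_reduce (rev (map inv_letter w)) (foldr cons_reduce w []) = []"
      by (rule foldr_cons_reduce_inverse) simp
    moreover have "foldr cons_reduce w [] = w"
      using w by (intro foldr_cons_reduce_Nil) (simp add: free_group_def)
    ultimately show "rev (map inv_letter w) \<otimes>\<^bsub>free_group m\<^esub> w = \<one>\<^bsub>free_group m\<^esub>"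
      by (simp add: free_group_def)
  qed
next
  fix u v assume "u \<in> carrier (free_group m)" "v \<in> carrier (free_group m)"
  then show "u \<otimes>\<^bsub>free_group m\<^esub> v \<in> carrier (free_group m)"
    using set_foldr[of u v] by (auto simp: free_group_def intro: reduced_foldr)
qed (auto simp: free_group_def foldr_foldr_cons_reduce)


section \<open>Word norms\<close>

definition word_norm :: "('a, 'b) monoid_scheme \<Rightarrow> 'a set \<Rightarrow> 'a \<Rightarrow> nat" where
  "word_norm G X g =
     (LEAST k. \<exists>xs. length xs = k \<and> set xs \<subseteq> X \<and> g = foldr (mult G) xs (one G))"

definition std_gens :: "nat \<Rightarrow> letter list set" where
  "std_gens m = (let A = (\<lambda>i. [(i, True)]) ` {..<m} in A \<union> m_inv (free_group m) ` A)"

definition conj_gens :: "nat \<Rightarrow> letter list set" where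
  "conj_gens m =
     {g \<otimes>\<^bsub>free_group m\<^esub> s \<otimes>\<^bsub>free_group m\<^esub> inv\<^bsub>free_group m\<^esub> g | g s.
        g \<in> carrier (free_group m) \<and> s \<in> std_gens m}"

definition std_length :: "nat \<Rightarrow> letter list \<Rightarrow> nat" where
  "std_length m w = word_norm (free_group m) (std_gens m) w"

definition conj_norm :: "nat \<Rightarrow> letter list \<Rightarrow> nat" where
  "conj_norm m w = word_norm (free_group m) (conj_gens m) w"


section \<open>Algorithms and their cost\<close>

text \<open>An algorithm is a while program over integer variables and two-dimensional integer tables,
  with read-only random access to the letters of the input word \<open>w\<close> at positions
  \<open>0, \<dots>, length w - 1\<close>. Indexing tables by pairs allows a table with quadratically many entries
  although no integer exceeds \<open>length w\<close>.\<close>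

datatype loc = Var string | Cell string int int

type_synonym store = "loc \<rightharpoonup> int"

datatype test =
    Less string string
  | Equal string string
  | LetterEq string string
  | LetterInv string string

datatype prog =
    Skip
  | Const string int
  | Copy string string
  | Add string string string
  | Load string string string string
  | Store string string string string
  | Seq prog prog
  | Branch test prog prog
  | While test prog

text \<open>The first two tests compare integers. The last two compare letters of the input, at the
  positions held by two variables: are they equal, and is one the inverse of the other?
  A test on an uninitialised variable, or on a position outside the word, has no outcome.\<close>

inductive outcome :: "letter list \<Rightarrow> test \<Rightarrow> store \<Rightarrow> bool \<Rightarrow> bool" for w :: "letter list" where
  "s (Var x) = Some a \<Longrightarrow> s (Var y) = Some b \<Longrightarrow>
     outcome w (Less x y) s (a < b)"
| "s (Var x) = Some a \<Longrightarrow> s (Var y) = Some b \<Longrightarrow>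
     outcome w (Equal x y) s (a = b)"
| "s (Var x) = Some (int i) \<Longrightarrow> s (Var y) = Some (int j) \<Longrightarrow> i < length w \<Longrightarrow> j < length w \<Longrightarrow>
     outcome w (LetterEq x y) s (w ! i = w ! j)"
| "s (Var x) = Some (int i) \<Longrightarrow> s (Var y) = Some (int j) \<Longrightarrow> i < length w \<Longrightarrow> j < length w \<Longrightarrow>
     outcome w (LetterInv x y) s (w ! i = inv_letter (w ! j))"

text \<open>\<open>exec w c s t s'\<close>: on input \<open>w\<close>, the program \<open>c\<close> started in \<open>s\<close> terminates in \<open>s'\<close> after
  \<open>t\<close> elementary operations. Every assignment, table access, addition and test costs 1. There is
  no execution that reads an uninitialised location or that produces an integer of size greater
  than \<open>length w\<close>.\<close>

inductive exec :: "letter list \<Rightarrow> prog \<Rightarrow> store \<Rightarrow> nat \<Rightarrow> store \<Rightarrow> bool" for w :: "letter list" where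
  Skip: "exec w Skip s 0 s"
| Const: "\<bar>k\<bar> \<le> int (length w) \<Longrightarrow>
    exec w (Const x k) s 1 (s(Var x \<mapsto> k))"
| Copy: "s (Var y) = Some a \<Longrightarrow>
    exec w (Copy x y) s 1 (s(Var x \<mapsto> a))"
| Add: "s (Var y) = Some a \<Longrightarrow> s (Var z) = Some b \<Longrightarrow> \<bar>a + b\<bar> \<le> int (length w) \<Longrightarrow>
    exec w (Add x y z) s 1 (s(Var x \<mapsto> a + b))"
| Load: "s (Var y) = Some i \<Longrightarrow> s (Var z) = Some j \<Longrightarrow> s (Cell A i j) = Some a \<Longrightarrow>
    exec w (Load x A y z) s 1 (s(Var x \<mapsto> a))"
| Store: "s (Var y) = Some i \<Longrightarrow> s (Var z) = Some j \<Longrightarrow> s (Var x) = Some a \<Longrightarrow>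
    exec w (Store A y z x) s 1 (s(Cell A i j \<mapsto> a))"
| Seq: "exec w c s t s' \<Longrightarrow> exec w d s' u s'' \<Longrightarrow>
    exec w (Seq c d) s (t + u) s''"
| BranchTrue: "outcome w b s True \<Longrightarrow> exec w c s t s' \<Longrightarrow>
    exec w (Branch b c d) s (1 + t) s'"
| BranchFalse: "outcome w b s False \<Longrightarrow> exec w d s t s' \<Longrightarrow>
    exec w (Branch b c d) s (1 + t) s'"
| WhileFalse: "outcome w b s False \<Longrightarrow>
    exec w (While b c) s 1 s"
| WhileTrue: "outcome w b s True \<Longrightarrow> exec w c s t s' \<Longrightarrow> exec w (While b c) s' u s'' \<Longrightarrow>
    exec w (While b c) s (1 + t + u) s''"

text \<open>Initially only the length of the input is stored, in the variable \<open>n\<close>; the answer is expected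
  in the variable \<open>r\<close>.\<close>

definition init :: "letter list \<Rightarrow> store" where
  "init w = [Var ''n'' \<mapsto> int (length w)]"

definition result :: "store \<Rightarrow> int option" where
  "result s = s (Var ''r'')"

text \<open>Locations are never freed, so the number of integers stored at the end of an execution is the
  maximum over the whole execution (\<open>exec_dom_mono\<close>, \<open>exec_finite_dom\<close>).\<close>

definition memory :: "store \<Rightarrow> nat" where
  "memory s = card (dom s)"

lemma exec_dom_mono: "exec w c s t s' \<Longrightarrow> dom s \<subseteq> dom s'"
  by (induction rule: exec.induct) auto

lemma exec_finite_dom: "exec w c s t s' \<Longrightarrow> finite (dom s) \<Longrightarrow> finite (dom s')"
  by (induction rule: exec.induct) auto

lemma outcome_det: "outcome w b s p \<Longrightarrow> outcome w b s q \<Longrightarrow> p = q"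
  by (induction rule: outcome.induct) (auto elim: outcome.cases)

lemma exec_det:
  "exec w c s t s' \<Longrightarrow> exec w c s t1 s1 \<Longrightarrow> t1 = t \<and> s1 = s'"
proof (induction arbitrary: t1 s1 rule: exec.induct)
  case (Seq c s t s' d u s'')
  from Seq.prems show ?case by cases (use Seq.IH in blast)
next
  case (BranchTrue b s c t s' d)
  from BranchTrue.prems show ?case
    by cases (use BranchTrue outcome_det in blast)+
next
  case (BranchFalse b s d t s' c)
  from BranchFalse.prems show ?case
    by cases (use BranchFalse outcome_det in blast)+
next
  case (WhileFalse b s c)
  from WhileFalse.prems show ?case
    by cases (use WhileFalse outcome_det in blast)+
next
  case (WhileTrue b s c t s' u s'')
  from WhileTrue.prems show ?case
    by cases (use WhileTrue.hyps WhileTrue.IH outcome_det in blast)+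
qed (erule exec.cases; simp)+

end

theory Submission
  imports Defs
begin

text \<open>The conjugation invariant norm of \<open>w\<close> is the least number of letters whose deletion turns
  \<open>w\<close> into a word that reduces to the identity. Indeed, deleting the letter \<open>x\<close> from \<open>u x v\<close>
  removes the conjugate \<open>u x u\<inverse>\<close> of a generator from the left, so a word that becomes trivial after
  \<open>k\<close> deletions is a product of at most \<open>k\<close> conjugates. Conversely, a product of \<open>k\<close> conjugates
  \<open>g s g\<inverse>\<close> is represented by a word that becomes trivial when its \<open>k\<close> letters \<open>s\<close> are deleted, and
  the reduced representative is no worse, because deletion numbers do not grow under free reduction.

  Words that are trivial after deletions are described by \<open>cancels\<close>: each letter is either deleted
  or paired with an inverse letter, and the pairs are nested. This form makes the number of
  deletions invariant under cyclic rotation (\<open>cancels_rotate\<close>), which brings any pair that a free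
  reduction removes to the two ends of the word, where removing it is easy
  (\<open>cancels_conjugate_letterD\<close>, \<open>cancels_reduce_pair\<close>). The two descriptions agree by
  \<open>conj_norm_eq_cancel_norm\<close>.

  The nested structure also gives the algorithm. If \<open>D i j\<close> is the deletion number of the factor of
  \<open>w\<close> at the positions from \<open>i\<close> up to but excluding \<open>j\<close>, the first letter of the factor is deleted or
  paired with some position \<open>q\<close>, so \<open>D i j\<close> is the minimum of \<open>1 + D (i + 1) j\<close> and of the numbers
  \<open>D (i + 1) q + D (q + 1) j\<close> (\<open>interval_norm_eq_Min\<close>). Filling a table of these values in
  decreasing order of \<open>i\<close> takes linear time for each of quadratically many entries. The number of
  deletions is at most the length of the factor, so all intermediate integers are bounded by the
  length of \<open>w\<close>; and this bound alone forces quadratic memory on every program, since table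
  indices are integers too (\<open>memory_bound\<close>).\<close>

section \<open>Cancellation in words\<close>

text \<open>\<open>cancels k w\<close>: deleting at most \<open>k\<close> letters of \<open>w\<close> leaves a word that reduces to the empty
  word. The bound is built to be upward closed (\<open>Nil\<close> holds for all \<open>k\<close>), because the manipulations
  below often save deletions.\<close>

inductive cancels :: "nat \<Rightarrow> letter list \<Rightarrow> bool" where
  Nil: "cancels k []"
| Delete: "cancels k w \<Longrightarrow> cancels (Suc k) (x # w)"
| Match: "cancels k u \<Longrightarrow> cancels l v \<Longrightarrow> cancels (k + l) (x # u @ inv_letter x # v)"

lemma cancels_mono: "cancels k w \<Longrightarrow> k \<le> k' \<Longrightarrow> cancels k' w"
proof (induction arbitrary: k' rule: cancels.induct)
  case (Delete k w x)
  then show ?case by (cases k') (auto intro: cancels.Delete)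
next
  case (Match k u l v x)
  from Match.prems have "cancels (k + (k' - k)) (x # u @ inv_letter x # v)"
    by (intro cancels.Match Match.hyps Match.IH) simp
  with Match.prems show ?case by simp
qed (rule cancels.Nil)

lemma cancels_append: "cancels k u \<Longrightarrow> cancels l v \<Longrightarrow> cancels (k + l) (u @ v)"
proof (induction rule: cancels.induct)
  case (Nil k)
  then show ?case by (auto intro: cancels_mono)
next
  case (Match k u l' v' x)
  then show ?case using cancels.Match[of k u "l' + l" "v' @ v" x] by (simp add: add.assoc)
qed (auto intro: cancels.Delete)

lemma cancels_ConsE:
  assumes "cancels k (x # w)"
  obtains (Delete) k' where "k = Suc k'" "cancels k' w"
  | (Match) k1 k2 u v where "k = k1 + k2" "w = u @ inv_letter x # v" "cancels k1 u" "cancels k2 v"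
  using assms by cases auto

lemma cancels_length: "cancels (length w) w"
  by (induction w) (auto intro: cancels.intros)

text \<open>If the first letter is deleted, it can be deleted at the other end as well; if it is paired with an
  inverse letter, that letter can be paired with it across the end of the word instead.\<close>

lemma cancels_rotate1: "cancels k w \<Longrightarrow> cancels k (rotate1 w)"
proof (cases w)
  case (Cons x v)
  assume "cancels k w"
  then have "cancels k (x # v)" using Cons by simp
  then have "cancels k (v @ [x])"
  proof (cases rule: cancels_ConsE)
    case (Delete k')
    then show ?thesis
      using cancels_append[OF Delete(2) cancels_length[of "[x]"]] by simp
  next
    case (Match k1 k2 u v')
    have "cancels (k2 + 0) (inv_letter x # v' @ inv_letter (inv_letter x) # [])"
      by (intro cancels.Match Match cancels.Nil)
    from cancels_append[OF Match(3) this] Match show ?thesis by simp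
  qed
  with Cons show ?thesis by simp
qed simp

lemma cancels_rotate: "cancels k (u @ v) \<Longrightarrow> cancels k (v @ u)"
proof -
  assume "cancels k (u @ v)"
  then have "cancels k (rotate p (u @ v))" for p
    by (induction p) (simp_all add: cancels_rotate1)
  from this[of "length u"] show ?thesis by (simp add: rotate_append)
qed

text \<open>If the removed letter was paired, its partner loses its mate and is deleted instead.\<close>

lemma cancels_tl: "cancels k (x # w) \<Longrightarrow> cancels (Suc k) w"
proof (erule cancels_ConsE)
  fix k1 k2 u v
  assume "k = k1 + k2" "w = u @ inv_letter x # v" "cancels k1 u" "cancels k2 v"
  then show ?thesis using cancels_append[OF \<open>cancels k1 u\<close> cancels.Delete[of k2 v]] by simp
qed (auto intro: cancels_mono)

text \<open>If the first letter is deleted, this deletion pays for the one that removing the last letter may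
  require. If it is paired with an inner \<open>x\<close>, that \<open>x\<close> takes over the role of the last letter, by
  rotation of the part after it.\<close>

lemma cancels_conjugate_letterD: "cancels k (inv_letter x # w @ [x]) \<Longrightarrow> cancels k w"
proof (erule cancels_ConsE)
  fix k' assume k: "k = Suc k'" "cancels k' (w @ [x])"
  then have "cancels k' (x # w)" using cancels_rotate[of k' w "[x]"] by simp
  then show ?thesis using k(1) by (auto dest: cancels_tl)
next
  fix k1 k2 u v
  assume k: "k = k1 + k2" and w: "w @ [x] = u @ inv_letter (inv_letter x) # v"
    and u: "cancels k1 u" and v: "cancels k2 v"
  show ?thesis
  proof (cases v rule: rev_cases)
    case Nil
    with w u k show ?thesis by (auto intro: cancels_mono)
  next
    case (snoc v' y)
    with w have "w = u @ x # v'" "y = x" by auto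
    moreover from v snoc \<open>y = x\<close> have "cancels k2 (x # v')"
      using cancels_rotate[of k2 v' "[x]"] by simp
    ultimately show ?thesis using cancels_append[OF u] k by simp
  qed
qed

text \<open>Rotation turns an inverse pair at adjacent positions into the first and the last letter.\<close>

lemma cancels_reduce_pair: "cancels k (u @ x # inv_letter x # v) \<Longrightarrow> cancels k (u @ v)"
proof -
  assume "cancels k (u @ x # inv_letter x # v)"
  then have "cancels k (inv_letter x # (v @ u) @ [x])"
    using cancels_rotate[of k "u @ [x]" "inv_letter x # v"] by simp
  from cancels_rotate[OF cancels_conjugate_letterD[OF this]] show ?thesis .
qed

text \<open>The prefix \<open>p\<close> is there to allow reductions in the middle of a word and to carry the induction.\<close>

lemma cancels_reduce: "cancels k (p @ u @ v) \<Longrightarrow> cancels k (p @ foldr cons_reduce u v)"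
proof (induction u arbitrary: p)
  case (Cons x u)
  from Cons.IH[of "p @ [x]"] Cons.prems have *: "cancels k (p @ x # foldr cons_reduce u v)" by simp
  show ?case
  proof (cases "foldr cons_reduce u v")
    case Nil
    with * show ?thesis by simp
  next
    case (Cons y z)
    with * show ?thesis using cancels_reduce_pair[of k p x z] by auto
  qed
qed simp

lemma cancels_conjugate: "cancels k w \<Longrightarrow> cancels k (g @ w @ rev (map inv_letter g))"
proof (induction g)
  case (Cons x g)
  from cancels.Match[OF Cons.IH[OF Cons.prems] cancels.Nil[of 0], of x] show ?case by simp
qed simp


section \<open>The biinvariant norm counts cancelled letters\<close>

lemma mult_free_group: "u \<otimes>\<^bsub>free_group m\<^esub> v = foldr cons_reduce u v"
  by (simp add: free_group_def)

lemma one_free_group: "\<one>\<^bsub>free_group m\<^esub> = []"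
  by (simp add: free_group_def)

lemma carrier_free_group: "carrier (free_group m) = {w. reduced w \<and> (\<forall>x\<in>set w. fst x < m)}"
  by (simp add: free_group_def)

lemma inv_free_group:
  assumes "w \<in> carrier (free_group m)"
  shows "inv\<^bsub>free_group m\<^esub> w = rev (map inv_letter w)"
proof -
  interpret group "free_group m" by (rule group_free_group)
  have "foldr cons_reduce (rev (map inv_letter w)) (foldr cons_reduce w []) = []"
    by (rule foldr_cons_reduce_inverse) simp
  moreover have "foldr cons_reduce w [] = w"
    using assms by (intro foldr_cons_reduce_Nil) (simp add: carrier_free_group)
  ultimately show ?thesis
    using assms
    by (intro inv_equality)
       (auto simp: mult_free_group one_free_group carrier_free_group reduced_inverse)
qed

lemma std_gens_eq: "std_gens m = {[x] | x. fst x < m}"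
proof -
  have "m_inv (free_group m) ` (\<lambda>i. [(i, True)]) ` {..<m} = (\<lambda>i. [(i, False)]) ` {..<m}"
    by (auto simp: image_image inv_free_group carrier_free_group reduced_Cons inv_letter_def
        intro!: image_cong)
  then show ?thesis
    unfolding std_gens_def Let_def by (auto simp: image_iff)
qed

lemma singleton_carrier: "fst x < m \<Longrightarrow> [x] \<in> carrier (free_group m)"
  by (simp add: carrier_free_group reduced_Cons)

lemma Cons_eq_mult:
  assumes "x # w \<in> carrier (free_group m)"
  shows "x # w = [x] \<otimes>\<^bsub>free_group m\<^esub> w" "fst x < m" "w \<in> carrier (free_group m)"
proof -
  show "fst x < m" "w \<in> carrier (free_group m)"
    using assms by (auto simp: carrier_free_group reduced_Cons)
  show "x # w = [x] \<otimes>\<^bsub>free_group m\<^esub> w"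
    using assms by (cases w) (auto simp: mult_free_group carrier_free_group reduced_Cons)
qed

lemma append_eq_mult:
  assumes "u @ v \<in> carrier (free_group m)"
  shows "u @ v = u \<otimes>\<^bsub>free_group m\<^esub> v" "u \<in> carrier (free_group m)" "v \<in> carrier (free_group m)"
proof -
  have red: "reduced u" "reduced v"
    using assms by (auto simp: carrier_free_group reduced_def successively_append_iff)
  then show "u \<in> carrier (free_group m)" "v \<in> carrier (free_group m)"
    using assms by (auto simp: carrier_free_group)
  have "u @ v = foldr cons_reduce u (foldr cons_reduce v [])"
    using foldr_cons_reduce_Nil[of "u @ v"] assms by (simp add: carrier_free_group)
  then show "u @ v = u \<otimes>\<^bsub>free_group m\<^esub> v"
    using red by (simp add: foldr_cons_reduce_Nil mult_free_group)
qed

text \<open>Multiplication by a generator changes the length of a reduced word by at most one, so no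
  product of fewer than \<open>length w\<close> generators reaches \<open>w\<close>.\<close>

lemma std_length_eq_length:
  assumes "w \<in> carrier (free_group m)"
  shows "std_length m w = length w"
  unfolding std_length_def word_norm_def
proof (rule Least_equality)
  have "foldr (mult (free_group m)) (map (\<lambda>x. [x]) w) [] = w"
    using assms
  proof (induction w)
    case (Cons x w)
    note x = Cons_eq_mult[OF Cons.prems]
    have "foldr (mult (free_group m)) (map (\<lambda>x. [x]) (x # w)) [] = [x] \<otimes>\<^bsub>free_group m\<^esub> w"
      using Cons.IH[OF x(3)] by simp
    then show ?case using x(1) by metis
  qed simp
  then show "\<exists>xs. length xs = length w \<and> set xs \<subseteq> std_gens m \<and>
      w = foldr (mult (free_group m)) xs \<one>\<^bsub>free_group m\<^esub>"
    using assms by (intro exI[of _ "map (\<lambda>x. [x]) w"])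
      (auto simp: one_free_group std_gens_eq carrier_free_group)
next
  fix k
  assume "\<exists>xs. length xs = k \<and> set xs \<subseteq> std_gens m \<and>
      w = foldr (mult (free_group m)) xs \<one>\<^bsub>free_group m\<^esub>"
  then obtain xs where xs: "length xs = k" "set xs \<subseteq> std_gens m"
    "w = foldr (mult (free_group m)) xs []" by (auto simp: one_free_group)
  have len: "length (cons_reduce x v) \<le> Suc (length v)" for x v by (cases v) auto
  have "set xs \<subseteq> std_gens m \<Longrightarrow> length (foldr (mult (free_group m)) xs []) \<le> length xs"
  proof (induction xs)
    case (Cons y xs)
    then obtain x where "y = [x]" by (auto simp: std_gens_eq)
    with Cons show ?case
      using len[of x "foldr (mult (free_group m)) xs []"]
      by (simp add: mult_free_group[of m "[x]"])
  qed simp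
  with xs show "length w \<le> k" by simp
qed

text \<open>In the unreduced word for a product of conjugates \<open>g x g\<inverse>\<close> it suffices to delete the letters
  \<open>x\<close>; free reduction preserves this.\<close>

lemma conj_product_cancels:
  assumes "set xs \<subseteq> conj_gens m"
  shows "cancels (length xs) (foldr (mult (free_group m)) xs [])"
  using assms
proof (induction xs)
  case (Cons y xs)
  from Cons.prems obtain g x where g: "g \<in> carrier (free_group m)" "fst x < m"
    and y: "y = g \<otimes>\<^bsub>free_group m\<^esub> [x] \<otimes>\<^bsub>free_group m\<^esub> inv\<^bsub>free_group m\<^esub> g"
    by (auto simp: conj_gens_def std_gens_eq)
  have "cancels 1 (g @ [x] @ rev (map inv_letter g))"
    using cancels_conjugate[OF cancels_length[of "[x]"]] by simp
  then have "cancels 1 (foldr cons_reduce g (foldr cons_reduce [x] (rev (map inv_letter g))))"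
    using cancels_reduce[of 1 g "[x]" "rev (map inv_letter g)"]
      cancels_reduce[of 1 "[]" g "foldr cons_reduce [x] (rev (map inv_letter g))"] by simp
  also have "foldr cons_reduce g (foldr cons_reduce [x] (rev (map inv_letter g))) = y"
  proof -
    interpret group "free_group m" by (rule group_free_group)
    show ?thesis unfolding y using g singleton_carrier[of x m]
      by (simp only: m_assoc inv_closed inv_free_group[symmetric] mult_free_group[symmetric, of _ _ m])
  qed
  finally have "cancels (length (y # xs)) (y @ foldr (mult (free_group m)) xs [])"
    using cancels_append Cons by fastforce
  then show ?case
    using cancels_reduce[of _ "[]" y "foldr (mult (free_group m)) xs []"]
    by (simp add: mult_free_group[symmetric, of _ _ m])
qed (auto intro: cancels.Nil)

text \<open>Each deletion contributes a generator, and each pair conjugates what it encloses, which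
  replaces conjugates of generators by other such conjugates. All words that occur are factors of
  the reduced word \<open>w\<close>, so concatenation and multiplication agree on them.\<close>

lemma cancels_conj_product:
  assumes "cancels k w" "w \<in> carrier (free_group m)"
  shows "\<exists>xs. length xs \<le> k \<and> set xs \<subseteq> conj_gens m \<and>
    w = foldr (mult (free_group m)) xs \<one>\<^bsub>free_group m\<^esub>"
  using assms
proof (induction rule: cancels.induct)
  case (Nil k)
  then show ?case by (intro exI[of _ "[]"]) (simp add: one_free_group)
next
  case (Delete k w x)
  interpret group "free_group m" by (rule group_free_group)
  note x = Cons_eq_mult[OF Delete.prems]
  have "[x] = \<one>\<^bsub>free_group m\<^esub> \<otimes>\<^bsub>free_group m\<^esub> [x] \<otimes>\<^bsub>free_group m\<^esub> inv\<^bsub>free_group m\<^esub> \<one>\<^bsub>free_group m\<^esub>"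
    using singleton_carrier[OF x(2)] by simp
  then have "[x] \<in> conj_gens m"
    unfolding conj_gens_def std_gens_eq using x(2) one_closed by blast
  moreover from Delete.IH[OF x(3)] obtain xs where "length xs \<le> k" "set xs \<subseteq> conj_gens m"
    "w = foldr (mult (free_group m)) xs \<one>\<^bsub>free_group m\<^esub>" by blast
  ultimately show ?case using x(1) by (intro exI[of _ "[x] # xs"]) auto
next
  case (Match k u l v x)
  interpret group "free_group m" by (rule group_free_group)
  let ?G = "free_group m" and ?c = "\<lambda>y. [x] \<otimes>\<^bsub>free_group m\<^esub> y \<otimes>\<^bsub>free_group m\<^esub> inv\<^bsub>free_group m\<^esub> [x]"
  note 1 = Cons_eq_mult[OF Match.prems]
  note 2 = append_eq_mult[OF 1(3)]
  note 3 = Cons_eq_mult[OF 2(3)]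
  note x = singleton_carrier[OF 1(2)]
  have inv_x: "[inv_letter x] = inv\<^bsub>?G\<^esub> [x]" using x by (simp add: inv_free_group)
  obtain xs ys where xs: "length xs \<le> k" "set xs \<subseteq> conj_gens m" "u = foldr (mult ?G) xs \<one>\<^bsub>?G\<^esub>"
    and ys: "length ys \<le> l" "set ys \<subseteq> conj_gens m" "v = foldr (mult ?G) ys \<one>\<^bsub>?G\<^esub>"
    using Match.IH(1)[OF 2(2)] Match.IH(2)[OF 3(3)] by blast
  have gens: "y \<in> carrier ?G" "?c y \<in> conj_gens m" if "y \<in> conj_gens m" for y
  proof -
    from that obtain g s where g: "g \<in> carrier ?G" and s: "s \<in> std_gens m"
      and y: "y = g \<otimes>\<^bsub>?G\<^esub> s \<otimes>\<^bsub>?G\<^esub> inv\<^bsub>?G\<^esub> g" by (auto simp: conj_gens_def)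
    have s': "s \<in> carrier ?G" using s by (auto simp: std_gens_eq singleton_carrier)
    then show "y \<in> carrier ?G" using y g by simp
    have "?c y = ([x] \<otimes>\<^bsub>?G\<^esub> g) \<otimes>\<^bsub>?G\<^esub> s \<otimes>\<^bsub>?G\<^esub> inv\<^bsub>?G\<^esub> ([x] \<otimes>\<^bsub>?G\<^esub> g)"
      using x g s' y by (simp add: m_assoc inv_mult_group)
    then show "?c y \<in> conj_gens m" using x g s by (auto simp: conj_gens_def)
  qed
  have carr: "foldr (mult ?G) zs \<one>\<^bsub>?G\<^esub> \<in> carrier ?G" if "set zs \<subseteq> conj_gens m" for zs
    using that by (induction zs) (auto simp: gens)
  have "foldr (mult ?G) (map ?c xs @ ys) \<one>\<^bsub>?G\<^esub> =
      ?c (foldr (mult ?G) xs \<one>\<^bsub>?G\<^esub>) \<otimes>\<^bsub>?G\<^esub> foldr (mult ?G) ys \<one>\<^bsub>?G\<^esub>"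
    using xs(2)
  proof (induction xs)
    case Nil
    then show ?case using x carr[OF ys(2)] by (simp add: m_assoc)
  next
    case (Cons y xs)
    have cl: "y \<in> carrier ?G" "foldr (mult ?G) xs \<one>\<^bsub>?G\<^esub> \<in> carrier ?G"
      using Cons.prems by (auto simp: gens carr)
    have cancel: "inv\<^bsub>?G\<^esub> [x] \<otimes>\<^bsub>?G\<^esub> ([x] \<otimes>\<^bsub>?G\<^esub> z) = z" if "z \<in> carrier ?G" for z
      using that x by (simp add: m_assoc[symmetric])
    show ?case using Cons x cl carr[OF ys(2)] by (simp add: m_assoc cancel)
  qed
  moreover have "x # u @ inv_letter x # v = ?c u \<otimes>\<^bsub>?G\<^esub> v"
    using 1(1) 2 3 x by (simp add: inv_x m_assoc)
  ultimately show ?case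
    using xs ys gens by (intro exI[of _ "map ?c xs @ ys"]) auto
qed

definition cancel_norm :: "letter list \<Rightarrow> nat" where
  "cancel_norm w = (LEAST k. cancels k w)"

lemma cancels_cancel_norm: "cancels (cancel_norm w) w"
  unfolding cancel_norm_def by (rule LeastI[of "\<lambda>k. cancels k w", OF cancels_length])

lemma cancel_norm_le: "cancels k w \<Longrightarrow> cancel_norm w \<le> k"
  unfolding cancel_norm_def by (rule Least_le)

lemma conj_norm_eq_cancel_norm:
  assumes "w \<in> carrier (free_group m)"
  shows "conj_norm m w = cancel_norm w"
proof -
  let ?P = "\<lambda>k. \<exists>xs. length xs = k \<and> set xs \<subseteq> conj_gens m \<and>
    w = foldr (mult (free_group m)) xs \<one>\<^bsub>free_group m\<^esub>"
  obtain k where k: "k \<le> cancel_norm w" "?P k"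
    using cancels_conj_product[OF cancels_cancel_norm assms] by blast
  have "cancel_norm w \<le> l" if "?P l" for l
    using that conj_product_cancels[of _ m] by (auto simp: one_free_group intro!: cancel_norm_le)
  note least = this
  from k least[OF k(2)] have "?P (cancel_norm w)" by simp
  then show ?thesis
    unfolding conj_norm_def word_norm_def using least by (rule Least_equality)
qed


section \<open>The interval recurrence\<close>

lemma cancel_norm_Nil [simp]: "cancel_norm [] = 0"
  using cancel_norm_le[OF cancels.Nil[of 0]] by simp

lemma cancel_norm_le_length: "cancel_norm w \<le> length w"
  by (rule cancel_norm_le[OF cancels_length])

text \<open>The recurrence distinguishes whether the first letter is deleted or paired with position \<open>p\<close> of
  the rest.\<close>

lemma cancel_norm_Cons:
  "cancel_norm (x # w) = Min (insert (Suc (cancel_norm w))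
     ((\<lambda>p. cancel_norm (take p w) + cancel_norm (drop (Suc p) w)) `
       {p. p < length w \<and> w ! p = inv_letter x}))"
  (is "_ = Min (insert ?a (?f ` ?P))")
proof (rule antisym)
  have fin: "finite (insert ?a (?f ` ?P))" by simp
  show "Min (insert ?a (?f ` ?P)) \<le> cancel_norm (x # w)"
    using cancels_cancel_norm[of "x # w"]
  proof (cases rule: cancels_ConsE)
    case (Delete k)
    then show ?thesis using cancel_norm_le[of k w] by (intro Min.coboundedI[OF fin, THEN order_trans]) auto
  next
    case (Match k1 k2 u v)
    then have "length u \<in> ?P" "?f (length u) \<le> cancel_norm (x # w)"
      using cancel_norm_le[of k1 u] cancel_norm_le[of k2 v] by (auto simp: nth_append)
    then show ?thesis by (intro Min.coboundedI[OF fin, THEN order_trans]) auto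
  qed
  show "cancel_norm (x # w) \<le> Min (insert ?a (?f ` ?P))"
  proof (rule Min.boundedI[OF fin])
    fix k assume "k \<in> insert ?a (?f ` ?P)"
    then consider "k = ?a" | p where "p < length w" "w ! p = inv_letter x" "k = ?f p" by auto
    then have "cancels k (x # w)"
    proof cases
      case 1
      then show ?thesis by (simp add: cancels.Delete cancels_cancel_norm)
    next
      case (2 p)
      have "cancels (?f p) (x # take p w @ inv_letter x # drop (Suc p) w)"
        by (intro cancels.Match cancels_cancel_norm)
      with 2 show ?thesis by (metis id_take_nth_drop)
    qed
    then show "cancel_norm (x # w) \<le> k" by (rule cancel_norm_le)
  qed simp
qed

text \<open>Intervals are half open, so an interval has its length as the difference of its ends, and the
  parts inside and after a pair at \<open>i\<close> and \<open>q\<close> are the intervals from \<open>i + 1\<close> to \<open>q\<close> and from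
  \<open>q + 1\<close> to \<open>j\<close>.\<close>

definition interval_norm :: "letter list \<Rightarrow> nat \<Rightarrow> nat \<Rightarrow> nat" where
  "interval_norm w i j = cancel_norm (take (j - i) (drop i w))"

lemma interval_norm_le: "interval_norm w i j \<le> j - i"
  using cancel_norm_le_length[of "take (j - i) (drop i w)"] by (simp add: interval_norm_def)

text \<open>The candidates for the deletion number of an interval that an innermost loop has inspected once
  all partners before \<open>k\<close> have been tried; their minimum is its loop invariant.\<close>

definition options_upto :: "letter list \<Rightarrow> nat \<Rightarrow> nat \<Rightarrow> nat \<Rightarrow> nat set" where
  "options_upto w i j k = insert (Suc (interval_norm w (Suc i) j))
     ((\<lambda>q. interval_norm w (Suc i) q + interval_norm w (Suc q) j) `
       {q. i < q \<and> q < k \<and> w ! q = inv_letter (w ! i)})"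

lemma finite_options_upto [simp]: "finite (options_upto w i j k)"
  by (simp add: options_upto_def)

lemma options_upto_nonempty: "options_upto w i j k \<noteq> {}"
  by (simp add: options_upto_def)

lemma options_upto_start: "options_upto w i j (Suc i) = {Suc (interval_norm w (Suc i) j)}"
  by (auto simp: options_upto_def)

lemma options_upto_Suc:
  "i < k \<Longrightarrow> options_upto w i j (Suc k) =
    (if w ! k = inv_letter (w ! i)
     then insert (interval_norm w (Suc i) k + interval_norm w (Suc k) j) (options_upto w i j k)
     else options_upto w i j k)"
  by (auto simp: options_upto_def less_Suc_eq)

lemma interval_norm_eq_Min:
  assumes "i < j" "j \<le> length w"
  shows "interval_norm w i j = Min (options_upto w i j j)"
proof -
  let ?v = "take (j - Suc i) (drop (Suc i) w)"
  have "take (j - i) (drop i w) = w ! i # ?v"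
    using assms Cons_nth_drop_Suc[of i w] Suc_diff_Suc[of i j] by (metis less_le_trans take_Suc_Cons)
  moreover have "(\<lambda>p. cancel_norm (take p ?v) + cancel_norm (drop (Suc p) ?v)) `
       {p. p < length ?v \<and> ?v ! p = inv_letter (w ! i)} =
     (\<lambda>q. interval_norm w (Suc i) q + interval_norm w (Suc q) j) `
       {q. i < q \<and> q < j \<and> w ! q = inv_letter (w ! i)}" (is "?f ` ?P = ?g ` ?Q")
  proof -
    \<comment> \<open>positions within the tail of the interval are shifted by \<open>i + 1\<close> against positions in \<open>w\<close>\<close>
    have eq: "?g (Suc i + p) = ?f p" if "p < j - Suc i" for p
      using that assms
      by (simp add: interval_norm_def min_def drop_take algebra_simps)
    have "?Q = (+) (Suc i) ` ?P"
    proof (intro equalityI subsetI)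
      fix q assume "q \<in> ?Q"
      then show "q \<in> (+) (Suc i) ` ?P"
        using assms by (intro image_eqI[of _ _ "q - Suc i"]) auto
    qed (use assms in auto)
    then show ?thesis using eq assms by (auto simp: image_image intro!: image_cong)
  qed
  ultimately show ?thesis
    unfolding interval_norm_def[of w i j] options_upto_def interval_norm_def[of w "Suc i" j]
    by (simp only: cancel_norm_Cons)
qed


section \<open>Cost and memory of programs\<close>

text \<open>The weakest precondition of total correctness, with the running time available to the
  postcondition. Its equations for loop-free programs let the simplifier execute them
  symbolically.\<close>

definition wp :: "letter list \<Rightarrow> prog \<Rightarrow> store \<Rightarrow> (nat \<Rightarrow> store \<Rightarrow> bool) \<Rightarrow> bool" where
  "wp w c s Q \<longleftrightarrow> (\<exists>t s'. exec w c s t s' \<and> Q t s')"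

lemma wp_mono: "wp w c s Q \<Longrightarrow> (\<And>t s'. Q t s' \<Longrightarrow> R t s') \<Longrightarrow> wp w c s R"
  unfolding wp_def by blast

inductive_cases exec_SeqE: "exec w (Seq c d) s t s'"
inductive_cases exec_BranchE: "exec w (Branch b c d) s t s'"

lemma wp_Skip [simp]: "wp w Skip s Q \<longleftrightarrow> Q 0 s"
  unfolding wp_def by (subst exec.simps) auto

lemma wp_Const [simp]:
  "wp w (Const x k) s Q \<longleftrightarrow> \<bar>k\<bar> \<le> int (length w) \<and> Q 1 (s(Var x \<mapsto> k))"
  unfolding wp_def by (subst exec.simps) auto

lemma wp_Copy [simp]:
  "wp w (Copy x y) s Q \<longleftrightarrow> (\<exists>a. s (Var y) = Some a \<and> Q 1 (s(Var x \<mapsto> a)))"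
  unfolding wp_def by (subst exec.simps) auto

lemma wp_Add [simp]:
  "wp w (Add x y z) s Q \<longleftrightarrow> (\<exists>a b. s (Var y) = Some a \<and> s (Var z) = Some b \<and>
     \<bar>a + b\<bar> \<le> int (length w) \<and> Q 1 (s(Var x \<mapsto> a + b)))"
  unfolding wp_def by (subst exec.simps) auto

lemma wp_Load [simp]:
  "wp w (Load x A y z) s Q \<longleftrightarrow> (\<exists>i j a. s (Var y) = Some i \<and> s (Var z) = Some j \<and>
     s (Cell A i j) = Some a \<and> Q 1 (s(Var x \<mapsto> a)))"
  unfolding wp_def by (subst exec.simps) auto

lemma wp_Store [simp]:
  "wp w (Store A y z x) s Q \<longleftrightarrow> (\<exists>i j a. s (Var y) = Some i \<and> s (Var z) = Some j \<and>
     s (Var x) = Some a \<and> Q 1 (s(Cell A i j \<mapsto> a)))"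
  unfolding wp_def by (subst exec.simps) auto

lemma wp_Seq [simp]:
  "wp w (Seq c d) s Q \<longleftrightarrow> wp w c s (\<lambda>t s'. wp w d s' (\<lambda>u. Q (t + u)))"
  unfolding wp_def by (blast intro: exec.intros elim: exec_SeqE)

lemma wp_Branch [simp]:
  "wp w (Branch b c d) s Q \<longleftrightarrow>
     outcome w b s True \<and> wp w c s (\<lambda>t. Q (Suc t)) \<or>
     outcome w b s False \<and> wp w d s (\<lambda>t. Q (Suc t))"
proof
  assume "wp w (Branch b c d) s Q"
  then obtain t s' where "exec w (Branch b c d) s t s'" "Q t s'" unfolding wp_def by blast
  then show "outcome w b s True \<and> wp w c s (\<lambda>t. Q (Suc t)) \<or>
      outcome w b s False \<and> wp w d s (\<lambda>t. Q (Suc t))"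
    by (elim exec_BranchE) (auto simp: wp_def)
next
  assume "outcome w b s True \<and> wp w c s (\<lambda>t. Q (Suc t)) \<or>
      outcome w b s False \<and> wp w d s (\<lambda>t. Q (Suc t))"
  then obtain t s' where "exec w (Branch b c d) s (1 + t) s'" "Q (1 + t) s'"
    unfolding wp_def plus_1_eq_Suc[symmetric] by (blast intro: exec.BranchTrue exec.BranchFalse)
  then show "wp w (Branch b c d) s Q" unfolding wp_def by blast
qed

lemma outcome_Less [simp]:
  "outcome w (Less x y) s p \<longleftrightarrow>
     (\<exists>a b. s (Var x) = Some a \<and> s (Var y) = Some b \<and> p = (a < b))"
  by (auto intro: outcome.intros elim: outcome.cases)

lemma outcome_Equal [simp]:
  "outcome w (Equal x y) s p \<longleftrightarrow>
     (\<exists>a b. s (Var x) = Some a \<and> s (Var y) = Some b \<and> p = (a = b))"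
  by (auto intro: outcome.intros elim: outcome.cases)

lemma outcome_LetterInv [simp]:
  assumes "s (Var x) = Some (int i)" "s (Var y) = Some (int j)" "i < length w" "j < length w"
  shows "outcome w (LetterInv x y) s p \<longleftrightarrow> p = (w ! i = inv_letter (w ! j))"
  using assms by (subst outcome.simps) auto

text \<open>The rule for counting loops: \<open>I p\<close> is the invariant after \<open>p\<close> of the \<open>N\<close> rounds. Each round costs
  at most \<open>B\<close> and one test, and one more test ends the loop.\<close>

lemma wp_While:
  assumes body: "\<And>p s. p < N \<Longrightarrow> I p s \<Longrightarrow>
      outcome w b s True \<and> wp w c s (\<lambda>t s'. t \<le> B \<and> I (Suc p) s')"
    and exit: "\<And>s. I N s \<Longrightarrow> outcome w b s False"
    and start: "I 0 s"
  shows "wp w (While b c) s (\<lambda>t s'. t \<le> Suc (N * Suc B) \<and> I N s')"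
proof -
  have "wp w (While b c) s (\<lambda>t s'. t \<le> Suc (d * Suc B) \<and> I N s')"
    if "I (N - d) s" "d \<le> N" for d s
    using that
  proof (induction d arbitrary: s)
    case 0
    then show ?case unfolding wp_def using exec.WhileFalse[OF exit] by fastforce
  next
    case (Suc d)
    then obtain t s' where s': "outcome w b s True" "exec w c s t s'" "t \<le> B" "I (N - d) s'"
      using body[of "N - Suc d" s] by (auto simp: wp_def Suc_diff_Suc)
    with Suc.IH[of s'] Suc.prems obtain u s'' where
      "exec w (While b c) s' u s''" "u \<le> Suc (d * Suc B)" "I N s''"
      by (auto simp: wp_def)
    with s' exec.WhileTrue[OF s'(1,2)] show ?case
      unfolding wp_def by (intro exI[of _ "1 + t + u"] exI[of _ s'']) auto
  qed
  from this[of N s] start show ?thesis by simp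
qed

fun assigned_vars :: "prog \<Rightarrow> string set" where
  "assigned_vars (Const x k) = {x}"
| "assigned_vars (Copy x y) = {x}"
| "assigned_vars (Add x y z) = {x}"
| "assigned_vars (Load x A y z) = {x}"
| "assigned_vars (Seq c d) = assigned_vars c \<union> assigned_vars d"
| "assigned_vars (Branch b c d) = assigned_vars c \<union> assigned_vars d"
| "assigned_vars (While b c) = assigned_vars c"
| "assigned_vars _ = {}"

fun written_tables :: "prog \<Rightarrow> string set" where
  "written_tables (Store A y z x) = {A}"
| "written_tables (Seq c d) = written_tables c \<union> written_tables d"
| "written_tables (Branch b c d) = written_tables c \<union> written_tables d"
| "written_tables (While b c) = written_tables c"
| "written_tables _ = {}"

lemma finite_assigned_vars: "finite (assigned_vars c)"
  by (induction c) auto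

lemma finite_written_tables: "finite (written_tables c)"
  by (induction c) auto

text \<open>No execution produces an integer larger in size than the length of the input, so the table
  cells that a program can ever address form a square for each table.\<close>

definition bounded_store :: "letter list \<Rightarrow> store \<Rightarrow> bool" where
  "bounded_store w s \<longleftrightarrow> (\<forall>l a. s l = Some a \<longrightarrow> \<bar>a\<bar> \<le> int (length w))"

definition table_cells :: "letter list \<Rightarrow> prog \<Rightarrow> loc set" where
  "table_cells w c = (\<lambda>(A, i, j). Cell A i j) ` (written_tables c \<times>
     {- int (length w)..int (length w)} \<times> {- int (length w)..int (length w)})"

lemma table_cells_Un:
  "table_cells w (Seq c d) = table_cells w c \<union> table_cells w d"
  "table_cells w (Branch b c d) = table_cells w c \<union> table_cells w d"
  "table_cells w (While b c) = table_cells w c"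
  by (simp_all add: table_cells_def Sigma_Un_distrib1 image_Un)

lemma exec_bounded:
  "exec w c s t s' \<Longrightarrow> bounded_store w s \<Longrightarrow>
     bounded_store w s' \<and> dom s' \<subseteq> dom s \<union> Var ` assigned_vars c \<union> table_cells w c"
proof (induction rule: exec.induct)
  case (Store s y i z j x a A)
  then have "\<bar>i\<bar> \<le> int (length w)" "\<bar>j\<bar> \<le> int (length w)" "\<bar>a\<bar> \<le> int (length w)"
    unfolding bounded_store_def by blast+
  then have "Cell A i j \<in> table_cells w (Store A y z x)"
    by (auto simp: table_cells_def intro!: image_eqI[of _ _ "(A, i, j)"])
  with Store \<open>\<bar>a\<bar> \<le> int (length w)\<close> show ?case
    by (auto simp: bounded_store_def split: if_splits)
next
  case (Seq c s t s' d u s'')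
  then show ?case by (simp add: table_cells_Un image_Un) blast
next
  case (BranchTrue b s c t s' d)
  then show ?case by (simp add: table_cells_Un image_Un) blast
next
  case (BranchFalse b s d t s' c)
  then show ?case by (simp add: table_cells_Un image_Un) blast
next
  case (WhileFalse b s c)
  then show ?case by blast
next
  case (WhileTrue b s c t s' u s'')
  then show ?case by (simp add: table_cells_Un) blast
qed (simp_all add: bounded_store_def subset_insertI2)

lemma memory_bound:
  assumes "exec w c (init w) t s"
  shows "memory s \<le> Suc (card (assigned_vars c)) + card (written_tables c) * (2 * length w + 1)\<^sup>2"
proof -
  let ?n = "int (length w)"
  have "bounded_store w (init w)" by (simp add: bounded_store_def init_def)
  from exec_bounded[OF assms this]
  have sub: "dom s \<subseteq> Var ` insert ''n'' (assigned_vars c) \<union> table_cells w c"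
    by (auto simp: init_def)
  have fin: "finite (table_cells w c)" by (simp add: table_cells_def finite_written_tables)
  have "card (table_cells w c) \<le> card (written_tables c \<times> {- ?n..?n} \<times> {- ?n..?n})"
    unfolding table_cells_def by (intro card_image_le) (simp add: finite_written_tables)
  also have "card {- ?n..?n} = 2 * length w + 1" by simp
  then have "card (written_tables c \<times> {- ?n..?n} \<times> {- ?n..?n}) =
      card (written_tables c) * (2 * length w + 1)\<^sup>2"
    by (simp only: card_cartesian_product power2_eq_square)
  finally have cells: "card (table_cells w c) \<le> card (written_tables c) * (2 * length w + 1)\<^sup>2" .
  have "card (Var ` insert ''n'' (assigned_vars c)) \<le> Suc (card (assigned_vars c))"
    using card_image_le[of "insert ''n'' (assigned_vars c)" Var] finite_assigned_vars[of c]
    by (simp add: card_insert_if split: if_splits)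
  moreover have "memory s \<le> card (Var ` insert ''n'' (assigned_vars c)) + card (table_cells w c)"
    unfolding memory_def
    by (rule order_trans[OF card_mono[OF _ sub] card_Un_le]) (simp add: fin finite_assigned_vars)
  ultimately show ?thesis using cells by linarith
qed

section \<open>The dynamic programme\<close>

text \<open>The table \<open>D\<close> has the deletion number of the interval from \<open>i\<close> to \<open>j\<close> in cell \<open>(i, j)\<close>;
  \<open>a\<close> is the minimum found so far for the current cell, and \<open>i1\<close>, \<open>k1\<close> are the successors of \<open>i\<close> and
  \<open>k\<close>. The variables \<open>j\<close> and \<open>i\<close> are changed at the start of a loop body rather than at its end, so
  that they never leave the range from 0 to \<open>n\<close>.\<close>

definition try_partner :: prog where
  "try_partner =
     Seq (Add ''k1'' ''k'' ''one'')
    (Seq (Branch (LetterInv ''k'' ''i'')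
           (Seq (Load ''b'' ''D'' ''i1'' ''k'')
           (Seq (Load ''c'' ''D'' ''k1'' ''j'')
           (Seq (Add ''b'' ''b'' ''c'')
                (Branch (Less ''b'' ''a'') (Copy ''a'' ''b'') Skip))))
           Skip)
         (Copy ''k'' ''k1''))"

definition fill_cell :: prog where
  "fill_cell =
     Seq (Add ''j'' ''j'' ''one'')
    (Seq (Load ''a'' ''D'' ''i1'' ''j'')
    (Seq (Add ''a'' ''a'' ''one'')
    (Seq (Copy ''k'' ''i1'')
    (Seq (While (Less ''k'' ''j'') try_partner)
         (Store ''D'' ''i'' ''j'' ''a'')))))"

definition fill_row :: prog where
  "fill_row =
     Seq (Copy ''i1'' ''i'')
    (Seq (Add ''i'' ''i'' ''minus'')
    (Seq (Store ''D'' ''i'' ''i'' ''zero'')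
    (Seq (Copy ''j'' ''i'')
         (While (Less ''j'' ''n'') fill_cell))))"

text \<open>The empty word is treated separately because for it the constants 1 and -1 exceed the bound on
  the size of integers.\<close>

definition norm_prog :: prog where
  "norm_prog =
     Seq (Const ''zero'' 0)
    (Branch (Equal ''n'' ''zero'')
      (Copy ''r'' ''zero'')
      (Seq (Const ''one'' 1)
      (Seq (Const ''minus'' (-1))
      (Seq (Copy ''i'' ''n'')
      (Seq (Store ''D'' ''i'' ''i'' ''zero'')
      (Seq (While (Less ''zero'' ''i'') fill_row)
           (Load ''r'' ''D'' ''i'' ''n'')))))))"

definition constants_ok :: "letter list \<Rightarrow> store \<Rightarrow> bool" where
  "constants_ok w s \<longleftrightarrow> s (Var ''n'') = Some (int (length w)) \<and> s (Var ''zero'') = Some 0 \<and>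
     s (Var ''one'') = Some 1 \<and> s (Var ''minus'') = Some (- 1)"

text \<open>Row \<open>i\<close> of the table is correct from the diagonal up to column \<open>j\<close>.\<close>

definition row_ok :: "letter list \<Rightarrow> nat \<Rightarrow> nat \<Rightarrow> store \<Rightarrow> bool" where
  "row_ok w i j s \<longleftrightarrow> (\<forall>b. i \<le> b \<longrightarrow> b \<le> j \<longrightarrow>
     s (Cell ''D'' (int i) (int b)) = Some (int (interval_norm w i b)))"

definition rows_ok :: "letter list \<Rightarrow> nat \<Rightarrow> store \<Rightarrow> bool" where
  "rows_ok w i s \<longleftrightarrow> (\<forall>a. i \<le> a \<longrightarrow> a \<le> length w \<longrightarrow> row_ok w a (length w) s)"

definition in_row :: "letter list \<Rightarrow> nat \<Rightarrow> store \<Rightarrow> bool" where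
  "in_row w i s \<longleftrightarrow> constants_ok w s \<and> i < length w \<and> rows_ok w (Suc i) s \<and>
     s (Var ''i'') = Some (int i) \<and> s (Var ''i1'') = Some (int (Suc i))"

definition in_cell :: "letter list \<Rightarrow> nat \<Rightarrow> nat \<Rightarrow> nat \<Rightarrow> store \<Rightarrow> bool" where
  "in_cell w i j k s \<longleftrightarrow> in_row w i s \<and> row_ok w i (j - 1) s \<and>
     s (Var ''j'') = Some (int j) \<and> s (Var ''k'') = Some (int k) \<and>
     s (Var ''a'') = Some (int (Min (options_upto w i j k)))"

lemma rows_okD:
  "rows_ok w i s \<Longrightarrow> i \<le> a \<Longrightarrow> a \<le> b \<Longrightarrow> b \<le> length w \<Longrightarrow>
     s (Cell ''D'' (int a) (int b)) = Some (int (interval_norm w a b))"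
  by (simp add: rows_ok_def row_ok_def)

lemma ok_Var_update [simp]:
  "row_ok w i j (s(Var x \<mapsto> a)) = row_ok w i j s"
  "rows_ok w i (s(Var x \<mapsto> a)) = rows_ok w i s"
  by (simp_all add: row_ok_def rows_ok_def)

lemma constants_ok_update [simp]:
  "x \<notin> {''n'', ''zero'', ''one'', ''minus''} \<Longrightarrow>
     constants_ok w (s(Var x \<mapsto> a)) = constants_ok w s"
  "constants_ok w (s(Cell A p q \<mapsto> a)) = constants_ok w s"
  by (auto simp: constants_ok_def)

lemma in_row_update [simp]:
  "x \<notin> {''n'', ''zero'', ''one'', ''minus'', ''i'', ''i1''} \<Longrightarrow>
     in_row w i (s(Var x \<mapsto> a)) = in_row w i s"
  by (auto simp: in_row_def)

text \<open>Both table entries that are read lie in rows below row \<open>i\<close>, because a partner \<open>k\<close> comes after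
  \<open>i\<close>. Their sum is at most the length of the interval, so the addition is admissible.\<close>

lemma wp_try_partner:
  assumes s: "in_cell w i j k s" and k: "i < k" "k < j" "j \<le> length w"
  shows "wp w try_partner s (\<lambda>t s'. t \<le> 8 \<and> in_cell w i j (Suc k) s')"
proof -
  have vals: "s (Var ''n'') = Some (int (length w))" "s (Var ''one'') = Some 1"
    "s (Var ''i'') = Some (int i)" "s (Var ''i1'') = Some (1 + int i)"
    "s (Var ''j'') = Some (int j)" "s (Var ''k'') = Some (int k)"
    "s (Var ''a'') = Some (int (Min (options_upto w i j k)))"
    and rows: "rows_ok w (Suc i) s"
    using s by (auto simp: in_cell_def in_row_def constants_ok_def)
  have cells: "s (Cell ''D'' (1 + int i) (int k)) = Some (int (interval_norm w (Suc i) k))"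
    "s (Cell ''D'' (int k + 1) (int j)) = Some (int (interval_norm w (Suc k) j))"
    using rows_okD[OF rows, of "Suc i" k] rows_okD[OF rows, of "Suc k" j] k
    by (simp_all add: add.commute)
  have small: "interval_norm w (Suc i) k + interval_norm w (Suc k) j \<le> length w"
    using interval_norm_le[of w "Suc i" k] interval_norm_le[of w "Suc k" j] k by linarith
  define c where "c = interval_norm w (Suc i) k + interval_norm w (Suc k) j"
  have step: "Min (options_upto w i j (Suc k)) =
      (if w ! k = inv_letter (w ! i) then min c (Min (options_upto w i j k))
       else Min (options_upto w i j k))"
    using k(1) by (simp add: options_upto_Suc options_upto_nonempty c_def)
  \<comment> \<open>the letters are compared after \<open>k1\<close> has been assigned\<close>
  have matched: "outcome w (LetterInv ''k'' ''i'') (s(Var ''k1'' \<mapsto> int k + 1)) p \<longleftrightarrow>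
      p = (w ! k = inv_letter (w ! i))" for p
    using k vals by (intro outcome_LetterInv) auto
  show ?thesis
    using s k vals cells small unfolding try_partner_def
    by (cases "w ! k = inv_letter (w ! i)")
       (auto simp: in_cell_def in_row_def step matched c_def min_def simp flip: of_nat_add)
qed

text \<open>When all partners before the end of the interval have been tried, the running minimum is the
  entry itself, by the recurrence.\<close>

lemma wp_fill_cell:
  assumes s: "in_row w i s" "row_ok w i j s" "s (Var ''j'') = Some (int j)"
    and j: "i \<le> j" "j < length w"
  shows "wp w fill_cell s (\<lambda>t s'. t \<le> 6 + 9 * length w \<and>
    in_row w i s' \<and> row_ok w i (Suc j) s' \<and> s' (Var ''j'') = Some (int (Suc j)))"
proof -
  have vals: "s (Var ''n'') = Some (int (length w))" "s (Var ''one'') = Some 1"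
    "s (Var ''i'') = Some (int i)" "s (Var ''i1'') = Some (1 + int i)"
    and rows: "rows_ok w (Suc i) s"
    using s by (auto simp: in_row_def constants_ok_def)
  have cell: "s (Cell ''D'' (1 + int i) (1 + int j)) = Some (int (interval_norm w (Suc i) (Suc j)))"
    using rows_okD[OF rows, of "Suc i" "Suc j"] j by simp
  have small: "Suc (interval_norm w (Suc i) (Suc j)) \<le> length w"
    using interval_norm_le[of w "Suc i" "Suc j"] j by linarith
  \<comment> \<open>the body increments \<open>j\<close> first, so the entry computed is the one in column \<open>j + 1\<close>\<close>
  have loop: "wp w (While (Less ''k'' ''j'') try_partner) s0 (\<lambda>t s'.
      t \<le> Suc ((j - i) * Suc 8) \<and> in_cell w i (Suc j) (Suc i + (j - i)) s')"
    if "in_cell w i (Suc j) (Suc i + 0) s0" for s0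
  proof (rule wp_While[where I = "\<lambda>p. in_cell w i (Suc j) (Suc i + p)", OF _ _ that])
    fix p s assume "p < j - i" "in_cell w i (Suc j) (Suc i + p) s"
    with wp_try_partner[of w i "Suc j" "Suc i + p" s] j
    show "outcome w (Less ''k'' ''j'') s True \<and> wp w try_partner s
        (\<lambda>t s'. t \<le> 8 \<and> in_cell w i (Suc j) (Suc i + Suc p) s')"
      by (auto simp: in_cell_def)
  qed (use j in \<open>auto simp: in_cell_def\<close>)
  have finish: "in_row w i (s'(Cell ''D'' (int i) (1 + int j) \<mapsto> int (Min (options_upto w i (Suc j) (Suc j)))))"
    "row_ok w i (Suc j) (s'(Cell ''D'' (int i) (1 + int j) \<mapsto> int (Min (options_upto w i (Suc j) (Suc j)))))"
    "s' (Var ''i'') = Some (int i)" "s' (Var ''j'') = Some (1 + int j)"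
    "s' (Var ''a'') = Some (int (Min (options_upto w i (Suc j) (Suc j))))"
    if "in_cell w i (Suc j) (Suc j) s'" for s'
    using that j interval_norm_eq_Min[of i "Suc j" w]
    by (auto simp: in_cell_def in_row_def rows_ok_def row_ok_def le_Suc_eq)
  have "(j - i) * 9 \<le> length w * 9" using j by simp
  then show ?thesis
    using s j vals cell small unfolding fill_cell_def
    by (auto simp: in_cell_def[of _ _ _ "Suc i"] options_upto_start add.commute finish
        intro!: wp_mono[OF loop])
qed

lemma wp_fill_row:
  assumes s: "constants_ok w s" "rows_ok w (Suc i) s" "s (Var ''i'') = Some (int (Suc i))"
    and i: "i < length w"
  shows "wp w fill_row s (\<lambda>t s'. t \<le> 5 + length w * (7 + 9 * length w) \<and>
    constants_ok w s' \<and> rows_ok w i s' \<and> s' (Var ''i'') = Some (int i))"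
proof -
  let ?I = "\<lambda>j s. in_row w i s \<and> row_ok w i j s \<and> s (Var ''j'') = Some (int j)"
  have loop: "wp w (While (Less ''j'' ''n'') fill_cell) s0 (\<lambda>t s'.
      t \<le> Suc ((length w - i) * Suc (6 + 9 * length w)) \<and> ?I (i + (length w - i)) s')"
    if "?I (i + 0) s0" for s0
  proof (rule wp_While[where I = "\<lambda>q. ?I (i + q)", OF _ _ that])
    fix q s assume "q < length w - i" "?I (i + q) s"
    with wp_fill_cell[of w i s "i + q"]
    show "outcome w (Less ''j'' ''n'') s True \<and> wp w fill_cell s
        (\<lambda>t s'. t \<le> 6 + 9 * length w \<and> ?I (i + Suc q) s')"
      by (auto simp: in_row_def constants_ok_def)
  qed (use i in \<open>auto simp: in_row_def constants_ok_def\<close>)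
  have bound: "t \<le> Suc (length w * (7 + 9 * length w))"
    if "t \<le> Suc ((length w - i) * (7 + 9 * length w))" for t
    using that by (rule order_trans) simp
  have finish: "constants_ok w s'" "rows_ok w i s'" "s' (Var ''i'') = Some (int i)"
    if "in_row w i s'" "row_ok w i (length w) s'" for s'
    using that Suc_leI[of i] unfolding in_row_def rows_ok_def by (auto simp: le_less)
  define s1 where "s1 = s(Var ''i1'' \<mapsto> 1 + int i, Var ''i'' \<mapsto> int i,
    Cell ''D'' (int i) (int i) \<mapsto> 0, Var ''j'' \<mapsto> int i)"
  have "interval_norm w i i = 0" by (simp add: interval_norm_def)
  then have "?I (i + 0) s1"
    using s i by (auto simp: s1_def in_row_def rows_ok_def row_ok_def)
  from loop[OF this] have "wp w (While (Less ''j'' ''n'') fill_cell) s1 (\<lambda>t s'.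
      t \<le> Suc (length w * (7 + 9 * length w)) \<and>
      constants_ok w s' \<and> rows_ok w i s' \<and> s' (Var ''i'') = Some (int i))"
    by (rule wp_mono) (use i in \<open>auto intro: bound finish\<close>)
  moreover have "s (Var ''zero'') = Some 0" "s (Var ''minus'') = Some (- 1)"
    using s(1) by (auto simp: constants_ok_def)
  ultimately show ?thesis
    using s(3) i unfolding fill_row_def s1_def by (auto elim!: wp_mono)
qed

lemma wp_norm_prog:
  "wp w norm_prog (init w) (\<lambda>t s. t \<le> 8 + length w * (6 + length w * (7 + 9 * length w)) \<and>
     result s = Some (int (cancel_norm w)))"
proof (cases "w = []")
  case True
  then show ?thesis unfolding norm_prog_def by (simp add: init_def result_def)
next
  case False
  let ?n = "length w"
  let ?I = "\<lambda>i s. constants_ok w s \<and> rows_ok w i s \<and> s (Var ''i'') = Some (int i)"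
  define s1 where "s1 = (init w)(Var ''zero'' \<mapsto> 0, Var ''one'' \<mapsto> 1, Var ''minus'' \<mapsto> - 1,
    Var ''i'' \<mapsto> int ?n, Cell ''D'' (int ?n) (int ?n) \<mapsto> 0)"
  have loop: "wp w (While (Less ''zero'' ''i'') fill_row) s1 (\<lambda>t s.
      t \<le> Suc (?n * Suc (5 + ?n * (7 + 9 * ?n))) \<and> ?I (?n - ?n) s)"
  proof (rule wp_While[where I = "\<lambda>p. ?I (?n - p)"])
    fix p s assume "p < ?n" "?I (?n - p) s"
    with wp_fill_row[of w s "?n - Suc p"]
    show "outcome w (Less ''zero'' ''i'') s True \<and> wp w fill_row s
        (\<lambda>t s'. t \<le> 5 + ?n * (7 + 9 * ?n) \<and> ?I (?n - Suc p) s')"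
      by (auto simp: constants_ok_def Suc_diff_Suc)
  next
    show "?I (?n - 0) s1"
      by (auto simp: s1_def constants_ok_def rows_ok_def row_ok_def init_def interval_norm_def)
  qed (auto simp: constants_ok_def)
  have finish: "s (Var ''i'') = Some 0" "s (Var ''n'') = Some (int ?n)"
    "s (Cell ''D'' 0 (int ?n)) = Some (int (cancel_norm w))" if "?I 0 s" for s
    using that rows_okD[of w 0 s 0 ?n] by (auto simp: constants_ok_def interval_norm_def)
  have "wp w (While (Less ''zero'' ''i'') fill_row) s1 (\<lambda>t s.
      t \<le> Suc (?n * (6 + ?n * (7 + 9 * ?n))) \<and> s (Var ''i'') = Some 0 \<and>
      s (Var ''n'') = Some (int ?n) \<and> s (Cell ''D'' 0 (int ?n)) = Some (int (cancel_norm w)))"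
    using loop
  proof (rule wp_mono)
    fix t s assume *: "t \<le> Suc (?n * Suc (5 + ?n * (7 + 9 * ?n))) \<and> ?I (?n - ?n) s"
    then have "?I 0 s" by simp
    from finish[OF this] * show "t \<le> Suc (?n * (6 + ?n * (7 + 9 * ?n))) \<and>
        s (Var ''i'') = Some 0 \<and> s (Var ''n'') = Some (int ?n) \<and>
        s (Cell ''D'' 0 (int ?n)) = Some (int (cancel_norm w))" by simp
  qed
  moreover have "1 \<le> int ?n" using False by (simp add: Suc_leI)
  ultimately show ?thesis
    using False unfolding norm_prog_def s1_def init_def
    by (auto simp: result_def elim!: wp_mono)
qed

text \<open>Bounds in terms of \<open>n + 1\<close> hold for the empty word too, and lose only the factor \<open>2 ^ d\<close> for
  positive \<open>n\<close>.\<close>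

lemma Suc_power_bigo: "(\<lambda>n. real (c * Suc n ^ d)) \<in> O(\<lambda>n. real n ^ d)"
proof (rule bigoI[where c = "real (c * 2 ^ d)"])
  show "\<forall>\<^sub>F n in sequentially. norm (real (c * Suc n ^ d)) \<le> real (c * 2 ^ d) * norm (real n ^ d)"
    using eventually_ge_at_top[of 1]
  proof eventually_elim
    case (elim n)
    then have "Suc n ^ d \<le> (2 * n) ^ d" by (intro power_mono) auto
    then have "c * Suc n ^ d \<le> c * 2 ^ d * n ^ d" by (simp add: power_mult_distrib)
    then have "real (c * Suc n ^ d) \<le> real (c * 2 ^ d * n ^ d)" by (rule of_nat_mono)
    then show ?case by simp
  qed
qed

theorem theorem1p3:
  fixes m :: nat
  shows "\<exists>(P :: prog) (T :: nat \<Rightarrow> nat) (M :: nat \<Rightarrow> nat).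
    (\<forall>w \<in> carrier (free_group m). \<exists>t s.
       exec w P (init w) t s \<and>
       result s = Some (int (conj_norm m w)) \<and>
       t \<le> T (std_length m w) \<and>
       memory s \<le> M (std_length m w)) \<and>
    (\<lambda>n. real (T n)) \<in> O(\<lambda>n. real n ^ 3) \<and>
    (\<lambda>n. real (M n)) \<in> O(\<lambda>n. real n ^ 2)"
proof -
  define a where "a = card (assigned_vars norm_prog)"
  define b where "b = card (written_tables norm_prog)"
  have "\<exists>t s. exec w norm_prog (init w) t s \<and> result s = Some (int (conj_norm m w)) \<and>
      t \<le> 30 * Suc (std_length m w) ^ 3 \<and>
      memory s \<le> (Suc a + 4 * b) * Suc (std_length m w) ^ 2"
    if w: "w \<in> carrier (free_group m)" for w
  proof -
    let ?n = "length w"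
    obtain t s where e: "exec w norm_prog (init w) t s" "result s = Some (int (cancel_norm w))"
      and t: "t \<le> 8 + ?n * (6 + ?n * (7 + 9 * ?n))"
      using wp_norm_prog[of w] by (auto simp: wp_def)
    have "8 + ?n * (6 + ?n * (7 + 9 * ?n)) \<le> 30 * Suc ?n ^ 3"
      by (simp add: power3_eq_cube algebra_simps)
    with t have "t \<le> 30 * Suc ?n ^ 3" by linarith
    moreover have "memory s \<le> Suc a * 1 + b * (2 * ?n + 1)\<^sup>2"
      using memory_bound[OF e(1)] by (simp add: a_def b_def)
    moreover have "Suc a * 1 \<le> Suc a * Suc ?n ^ 2" by (intro mult_le_mono) simp_all
    moreover have "b * (2 * ?n + 1)\<^sup>2 \<le> b * (4 * Suc ?n ^ 2)"
      by (intro mult_le_mono2) (simp add: power2_eq_square)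
    ultimately have "t \<le> 30 * Suc ?n ^ 3" "memory s \<le> Suc a * Suc ?n ^ 2 + b * (4 * Suc ?n ^ 2)"
      by linarith+
    moreover have "Suc a * Suc ?n ^ 2 + b * (4 * Suc ?n ^ 2) = (Suc a + 4 * b) * Suc ?n ^ 2"
      by (simp add: algebra_simps)
    ultimately show ?thesis
      unfolding conj_norm_eq_cancel_norm[OF w] std_length_eq_length[OF w] using e by metis
  qed
  then show ?thesis
    by (intro exI[of _ norm_prog] exI[of _ "\<lambda>n. 30 * Suc n ^ 3"]
        exI[of _ "\<lambda>n. (Suc a + 4 * b) * Suc n ^ 2"] conjI ballI Suc_power_bigo) blast
qed

end
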